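(* Let $G$ be a 2-connected outerplane bipartite graph. Then $\mathbf{M}(G)\cong\mathbf{J}(\mathbf{F}(G))$.
   Context: A connected plane graph is outerplane if all its vertices lie on the boundary of the outer face. Fix a proper white/black coloring of $G$. Let $G^*$ be the plane dual of $G$, with $e^*$, $f^*$ the dual edge/vertex of edge $e$/face $f$. Orient $G^*$ as $\vec G^*$: the dual edge $e^*$ is oriented from $f_1^*$ to $f_2^*$ if, going along $e^*$ from $f_1^*$ to $f_2^*$, the white end-vertex of $e$ lies on the right. $\vec G^\#$ is obtained from $\vec G^*$ by deleting the vertex corresponding to the outer face. $\mathcal{F}(G)$ is the set of inner faces, and $\mathbf{F}(G)$ is the poset on $\mathcal{F}(G)$ with $f_1\le f_2$ iff $\vec G^\#$ has a directed path from $f_2^*$ to $f_1^*$. For a finite poset $\mathbf{P}$, $\mathbf{J}(\mathbf{P})$ is the lattice of order ideals ordered by inclusion. A 1-factor is a perfect matching, $\mathcal{M}(G)$ the set of them; for $M\in\mathcal{M}(G)$ a cycle is $M$-alternating if its edges alternate in/out of $M$, and proper if each of its edges in $M$ goes from white to black end-vertex along the clockwise orientation. $\vec Z(G)$ has vertex set $\mathcal{M}(G)$ and an arc $M_1\to M_2$ when $M_1\oplus M_2$ bounds an inner face and is a proper $M_1$-alternating cycle; $\mathbf{M}(G)$ is the poset on $\mathcal{M}(G)$ with $M_1\preceq M_2$ iff $\vec Z(G)$ has a directed path from $M_2$ to $M_1$. *)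

theory Defs
  imports "Graph_Theory.Graph_Theory" "HOL-Combinatorics.Orbits"
begin

text \<open>
  A plane graph is represented by its rotation system.  The darts of a finite simple graph \<open>G\<close>
  are the ordered pairs \<open>(u, v) \<in> parcs G\<close>; each edge \<open>{u, v}\<close> carries the two darts \<open>(u, v)\<close>
  and \<open>(v, u)\<close>.  The permutation \<open>rot\<close> maps a dart to the next dart with the same tail in
  \<^emph>\<open>clockwise\<close> order around that tail.  With this convention, \<open>face_succ rot\<close> follows the
  boundary walk of the face that lies to the \<^emph>\<open>left\<close> of a dart: having arrived at \<open>v\<close> along
  \<open>(u, v)\<close>, the walk leaves \<open>v\<close> along the dart that follows \<open>(v, u)\<close> clockwise.  A face is
  identified with the set of darts that have it on their left.
\<close>

type_synonym 'a dart = "'a \<times> 'a"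
type_synonym 'a face = "'a dart set"

definition face_succ :: "('a dart \<Rightarrow> 'a dart) \<Rightarrow> 'a dart \<Rightarrow> 'a dart" where
  "face_succ rot d = rot (prod.swap d)"

definition left_face :: "('a dart \<Rightarrow> 'a dart) \<Rightarrow> 'a dart \<Rightarrow> 'a face" where
  "left_face rot d = orbit (face_succ rot) d"

definition faces :: "'a pair_pre_digraph \<Rightarrow> ('a dart \<Rightarrow> 'a dart) \<Rightarrow> 'a face set" where
  "faces G rot = left_face rot ` parcs G"

definition edge_of :: "'a dart \<Rightarrow> 'a set" where
  "edge_of d = {fst d, snd d}"

definition edges :: "'a pair_pre_digraph \<Rightarrow> 'a set set" where
  "edges G = edge_of ` parcs G"

text \<open>
  A connected rotation system is one of a graph drawn on the sphere iff its Euler characteristic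
  is 2; choosing the face that contains the point at infinity turns the sphere into the plane.
  (The graph with a single vertex, whose only face has no darts, is not covered.)
\<close>

definition plane_graph ::
    "'a pair_pre_digraph \<Rightarrow> ('a dart \<Rightarrow> 'a dart) \<Rightarrow> 'a face \<Rightarrow> bool" where
  "plane_graph G rot outer \<longleftrightarrow>
     pair_graph G \<and>
     Digraph_Component.connected (with_proj G) \<and>
     rot permutes parcs G \<and>
     (\<forall>v \<in> pverts G. cyclic_on rot (out_arcs (with_proj G) v)) \<and>
     int (card (pverts G)) - int (card (edges G)) + int (card (faces G rot)) = 2 \<and>
     outer \<in> faces G rot"

definition outerplane_graph ::
    "'a pair_pre_digraph \<Rightarrow> ('a dart \<Rightarrow> 'a dart) \<Rightarrow> 'a face \<Rightarrow> bool" where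
  "outerplane_graph G rot outer \<longleftrightarrow>
     plane_graph G rot outer \<and> (\<forall>v \<in> pverts G. \<exists>d \<in> outer. fst d = v)"

definition two_connected :: "'a pair_pre_digraph \<Rightarrow> bool" where
  "two_connected G \<longleftrightarrow>
     card (pverts G) \<ge> 3 \<and>
     Digraph_Component.connected (with_proj G) \<and>
     (\<forall>v \<in> pverts G. Digraph_Component.connected (pre_digraph.del_vert (with_proj G) v))"

datatype color = White | Black

definition proper_coloring :: "'a pair_pre_digraph \<Rightarrow> ('a \<Rightarrow> color) \<Rightarrow> bool" where
  "proper_coloring G c \<longleftrightarrow> (\<forall>(u, v) \<in> parcs G. c u \<noteq> c v)"

definition inner_faces ::
    "'a pair_pre_digraph \<Rightarrow> ('a dart \<Rightarrow> 'a dart) \<Rightarrow> 'a face \<Rightarrow> 'a face set" where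
  "inner_faces G rot outer = faces G rot - {outer}"

text \<open>
  The dual edge of an edge \<open>e\<close> is named by the dart \<open>d\<close> of \<open>e\<close> that leads from its white to its
  black end-vertex.  Crossing \<open>e\<close> from the face on the left of \<open>d\<close> to the face on the right of
  \<open>d\<close>, which is the face on the left of the reversed dart, one has the white end-vertex on the
  right.
\<close>

definition oriented_dual ::
    "'a pair_pre_digraph \<Rightarrow> ('a dart \<Rightarrow> 'a dart) \<Rightarrow> ('a \<Rightarrow> color) \<Rightarrow> ('a face, 'a dart) pre_digraph"
  where
  "oriented_dual G rot c =
     \<lparr> verts = faces G rot,
       arcs = {d \<in> parcs G. c (fst d) = White},
       tail = (\<lambda>d. left_face rot d),
       head = (\<lambda>d. left_face rot (prod.swap d)) \<rparr>"

definition inner_dual ::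
    "'a pair_pre_digraph \<Rightarrow> ('a dart \<Rightarrow> 'a dart) \<Rightarrow> 'a face \<Rightarrow> ('a \<Rightarrow> color) \<Rightarrow>
     ('a face, 'a dart) pre_digraph" where
  "inner_dual G rot outer c = pre_digraph.del_vert (oriented_dual G rot c) outer"

text \<open>Posets are reflexive relations \<open>r\<close> with carrier \<open>Field r\<close>; \<open>(x, y) \<in> r\<close> means \<open>x \<le> y\<close>.\<close>

definition face_poset ::
    "'a pair_pre_digraph \<Rightarrow> ('a dart \<Rightarrow> 'a dart) \<Rightarrow> 'a face \<Rightarrow> ('a \<Rightarrow> color) \<Rightarrow> 'a face rel" where
  "face_poset G rot outer c =
     {(f1, f2). f1 \<in> inner_faces G rot outer \<and> f2 \<in> inner_faces G rot outer \<and>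
                f2 \<rightarrow>\<^sup>*\<^bsub>inner_dual G rot outer c\<^esub> f1}"

definition order_ideals :: "'b rel \<Rightarrow> 'b set set" where
  "order_ideals r = {I. I \<subseteq> Field r \<and> (\<forall>x y. (x, y) \<in> r \<longrightarrow> y \<in> I \<longrightarrow> x \<in> I)}"

definition ideal_lattice :: "'b rel \<Rightarrow> 'b set rel" where
  "ideal_lattice r = {(I, J). I \<in> order_ideals r \<and> J \<in> order_ideals r \<and> I \<subseteq> J}"

definition poset_isomorphic :: "'b rel \<Rightarrow> 'c rel \<Rightarrow> bool" where
  "poset_isomorphic r s \<longleftrightarrow>
     (\<exists>h. bij_betw h (Field r) (Field s) \<and>
          (\<forall>x \<in> Field r. \<forall>y \<in> Field r. (x, y) \<in> r \<longleftrightarrow> (h x, h y) \<in> s))"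

definition perfect_matchings :: "'a pair_pre_digraph \<Rightarrow> 'a set set set" where
  "perfect_matchings G = {M. M \<subseteq> edges G \<and> (\<forall>v \<in> pverts G. \<exists>!e. e \<in> M \<and> v \<in> e)}"

definition is_facial_cycle :: "'a face \<Rightarrow> bool" where
  "is_facial_cycle f \<longleftrightarrow> card f \<ge> 3 \<and> inj_on fst f"

definition alternating ::
    "('a dart \<Rightarrow> 'a dart) \<Rightarrow> 'a set set \<Rightarrow> 'a face \<Rightarrow> bool" where
  "alternating rot M f \<longleftrightarrow>
     (\<forall>d \<in> f. edge_of d \<in> M \<longleftrightarrow> edge_of (face_succ rot d) \<notin> M)"

text \<open>
  The darts of an inner face have the face on their left, so they run counterclockwise along its
  boundary; the clockwise orientation consists of the reversed darts.
\<close>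

definition proper :: "('a \<Rightarrow> color) \<Rightarrow> 'a set set \<Rightarrow> 'a face \<Rightarrow> bool" where
  "proper c M f \<longleftrightarrow>
     (\<forall>(u, v) \<in> prod.swap ` f. {u, v} \<in> M \<longrightarrow> c u = White \<and> c v = Black)"

definition matching_digraph ::
    "'a pair_pre_digraph \<Rightarrow> ('a dart \<Rightarrow> 'a dart) \<Rightarrow> 'a face \<Rightarrow> ('a \<Rightarrow> color) \<Rightarrow>
     'a set set pair_pre_digraph" where
  "matching_digraph G rot outer c =
     \<lparr> pverts = perfect_matchings G,
       parcs = {(M1, M2). M1 \<in> perfect_matchings G \<and> M2 \<in> perfect_matchings G \<and>
                 (\<exists>f \<in> inner_faces G rot outer.
                    sym_diff M1 M2 = edge_of ` f \<and>
                    is_facial_cycle f \<and> alternating rot M1 f \<and> proper c M1 f)} \<rparr>"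

definition matching_poset ::
    "'a pair_pre_digraph \<Rightarrow> ('a dart \<Rightarrow> 'a dart) \<Rightarrow> 'a face \<Rightarrow> ('a \<Rightarrow> color) \<Rightarrow>
     'a set set rel" where
  "matching_poset G rot outer c =
     {(M1, M2). M1 \<in> perfect_matchings G \<and> M2 \<in> perfect_matchings G \<and>
                M2 \<rightarrow>\<^sup>*\<^bsub>with_proj (matching_digraph G rot outer c)\<^esub> M1}"

end

theory Submission
  imports Defs
begin

text \<open>
  By Euler's formula every edge set that is even at all vertices is the boundary, modulo 2, of a set
  of faces avoiding the outer one.  Applied to a cycle through a putative cut vertex, this shows that
  in a 2-connected plane graph no face has two corners at the same vertex; in the outerplane case
  each vertex therefore has exactly one outer corner.

  To an ideal \<open>I\<close> of inner faces assign the edges whose dual arc enters \<open>I\<close> (with \<open>outer\<close> counted as a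
  member at heads and as a non-member at tails).  Around a vertex the membership in \<open>I\<close> telescopes and
  only the single outer corner contributes, so this is a perfect matching.  Conversely the sum modulo
  2 of a perfect matching \<open>M\<close> with the matching of the empty ideal bounds a set of inner faces, and
  since \<open>M\<close> has only one edge at each vertex, this set is an ideal.  Rotating a face adds it to or
  removes it from the ideal.  Finally the inner dual is a tree, hence acyclic, and so any two nested
  ideals are linked by adding single faces.
\<close>

section \<open>Parity and orbits\<close>

lemma odd_card_sym_diff:
  assumes "finite A" "finite B"
  shows "odd (card (sym_diff A B)) \<longleftrightarrow> odd (card A) \<noteq> odd (card B)"
proof -
  have "card (sym_diff A B) = card (A - B) + card (B - A)"
    using assms by (intro card_Un_disjoint) auto
  moreover have "card A = card (A - B) + card (A \<inter> B)"
    using assms by (subst card_Un_disjoint[symmetric]) (auto intro: arg_cong[of _ _ card])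
  moreover have "card B = card (B - A) + card (A \<inter> B)"
    using assms by (subst card_Un_disjoint[symmetric]) (auto intro: arg_cong[of _ _ card])
  ultimately show ?thesis by presburger
qed

text \<open>Induction along a path in the symmetric closure of the arcs; \<open>closed\<close> is an
  equivalence because such a path may use arcs backwards.\<close>

lemma connected_closed_set:
  assumes "Digraph_Component.connected H" "W \<subseteq> verts H" "w \<in> W"
    and closed: "\<And>a. a \<in> arcs H \<Longrightarrow> tail H a \<in> W \<longleftrightarrow> head H a \<in> W"
  shows "W = verts H"
proof -
  have "v \<in> W" if "v \<in> verts H" for v
  proof -
    have "(w, v) \<in> rtrancl_on (verts H) ((arcs_ends H)\<^sup>s)"
      using assms(1-3) that unfolding connected_conv by blast
    then show ?thesis
      using assms(3)
      by (induction rule: rtrancl_on_induct) (auto simp: symcl_def arcs_ends_conv closed)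
  qed
  with assms(2) show ?thesis by auto
qed

lemma orbit_least_exponent:
  assumes "y \<in> orbit f x" "x \<noteq> y"
  obtains n where "(f ^^ n) x = y" "n > 0" "\<And>i. i < n \<Longrightarrow> (f ^^ i) x \<noteq> y"
    "inj_on (\<lambda>i. (f ^^ i) x) {..n}"
proof -
  define n where "n = (LEAST n. (f ^^ n) x = y)"
  have ex: "\<exists>n. (f ^^ n) x = y"
    using assms(1) by (auto simp: orbit_altdef)
  have n: "(f ^^ n) x = y"
    unfolding n_def using ex by (rule LeastI_ex)
  have least: "(f ^^ i) x \<noteq> y" if "i < n" for i
    using that not_less_Least unfolding n_def by blast
  have "n > 0"
    using n assms(2) by (cases n) auto
  have "(f ^^ i) x \<noteq> (f ^^ j) x" if "i < j" "j \<le> n" for i j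
  proof
    \<comment> \<open>A repetition could be cut out, and \<open>y\<close> would already be reached
      after \<open>n - j + i < n\<close> steps.\<close>
    assume "(f ^^ i) x = (f ^^ j) x"
    then have "(f ^^ (n - j)) ((f ^^ i) x) = (f ^^ (n - j)) ((f ^^ j) x)"
      by simp
    then have "(f ^^ (n - j + i)) x = y"
      using n that by (simp flip: comp_apply[of "f ^^ _" "f ^^ _"] funpow_add)
    with least[of "n - j + i"] that show False by simp
  qed
  then have "inj_on (\<lambda>i. (f ^^ i) x) {..n}"
    by (intro inj_onI) (metis atMost_iff linorder_neqE_nat)
  with that[of n] n least \<open>n > 0\<close> show thesis by blast
qed

section \<open>Plane graphs\<close>

locale plane_rotation_system =
  fixes G :: "'a pair_pre_digraph" and rot :: "'a dart \<Rightarrow> 'a dart" and outer :: "'a face"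
  assumes plane: "plane_graph G rot outer"
begin

abbreviation "V \<equiv> pverts G"
abbreviation "D \<equiv> parcs G"
abbreviation "E \<equiv> edges G"
abbreviation "L \<equiv> left_face rot"
abbreviation "F \<equiv> faces G rot"

definition out_darts :: "'a \<Rightarrow> 'a dart set" where
  "out_darts v = {d \<in> D. fst d = v}"

lemma pair_graph_G: "pair_graph G"
  using plane by (simp add: plane_graph_def)

lemma finite_V [simp, intro]: "finite V" and finite_D [simp, intro]: "finite D"
  using pair_graph_G
  by (auto simp: pair_graph_def pair_digraph_def pair_fin_digraph_def pair_fin_digraph_axioms_def)

lemma dart_verts: "d \<in> D \<Longrightarrow> fst d \<in> V" "d \<in> D \<Longrightarrow> snd d \<in> V"
  using pair_graph_G pair_wf_digraph.arc_fst_in_verts[of G d] pair_wf_digraph.arc_snd_in_verts[of G d]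
  by (simp_all add: pair_graph_def pair_digraph_def pair_fin_digraph_def)

lemma no_loop: "d \<in> D \<Longrightarrow> fst d \<noteq> snd d"
  using pair_graph_G pair_loopfree_digraph.pair_no_loops[of G d]
  by (simp add: pair_graph_def pair_digraph_def)

lemma swap_in_D [simp]: "prod.swap d \<in> D \<longleftrightarrow> d \<in> D"
proof -
  have "symmetric (with_proj G)"
    using pair_graph_G pair_sym_digraph.pair_sym_arcs
    by (auto simp: pair_graph_def pair_pseudo_graph_def)
  then show ?thesis
    by (cases d) (auto simp: symmetric_def dest: symD)
qed

lemma sym_D: "(u, v) \<in> D \<Longrightarrow> (v, u) \<in> D"
  using swap_in_D[of "(u, v)"] by simp

lemma finite_E [simp, intro]: "finite E"
  by (simp add: edges_def)

lemma finite_F [simp, intro]: "finite F"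
  by (simp add: faces_def)

lemma finite_out_darts [simp, intro]: "finite (out_darts v)"
  by (simp add: out_darts_def)

lemma rot_permutes: "rot permutes D"
  using plane by (simp add: plane_graph_def)

lemma rot_in_D [simp]: "rot d \<in> D \<longleftrightarrow> d \<in> D"
  using rot_permutes by (rule permutes_in_image)

lemma cyclic_rot: "v \<in> V \<Longrightarrow> cyclic_on rot (out_darts v)"
proof -
  assume v: "v \<in> V"
  have "out_darts v = out_arcs (with_proj G) v"
    by (auto simp: out_darts_def out_arcs_def)
  with v plane show ?thesis
    by (simp add: plane_graph_def)
qed

lemma fst_rot [simp]: "d \<in> D \<Longrightarrow> fst (rot d) = fst d"
  using cyclic_on_inI[OF cyclic_rot, of "fst d" d] dart_verts
  by (auto simp: out_darts_def)

lemma rot_in_out_darts: "d \<in> out_darts v \<Longrightarrow> rot d \<in> out_darts v"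
  by (auto simp: out_darts_def)

lemma bij_rot: "bij_betw rot (out_darts v) (out_darts v)"
proof -
  have "inj_on rot (out_darts v)"
    using permutes_inj[OF rot_permutes] by (rule inj_on_subset) simp
  moreover have "rot ` out_darts v \<subseteq> out_darts v"
    using rot_in_out_darts by blast
  ultimately show ?thesis
    unfolding bij_betw_def by (simp add: endo_inj_surj)
qed

lemma card_rot_eq: "card {d \<in> out_darts v. P (rot d)} = card {d \<in> out_darts v. P d}"
proof -
  have "(\<Sum>d \<in> out_darts v. of_bool (P (rot d))) = (\<Sum>d \<in> out_darts v. of_bool (P d) :: nat)"
    using bij_rot by (rule sum.reindex_bij_betw)
  then show ?thesis
    by (simp add: Int_def)
qed

lemma funpow_rot_in_D: "d \<in> D \<Longrightarrow> (rot ^^ n) d \<in> D \<and> fst ((rot ^^ n) d) = fst d"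
  by (induction n) auto

section \<open>Faces as orbits of the face walk\<close>

lemma cyclic_left_face: "d \<in> D \<Longrightarrow> cyclic_on (face_succ rot) (L d)"
  and self_in_left_face: "d \<in> D \<Longrightarrow> d \<in> L d"
  and left_face_subset: "d \<in> D \<Longrightarrow> L d \<subseteq> D"
proof -
  assume d: "d \<in> D"
  \<comment> \<open>Since \<open>rot\<close> fixes everything outside \<open>D\<close>,
    \<open>face_succ rot\<close> reverses pairs there; \<open>s\<close> is the identity there and so
    permutes \<open>D\<close>.\<close>
  define s where "s e = (if e \<in> D then face_succ rot e else e)" for e
  have "inj_on (face_succ rot) D"
    using permutes_inj[OF rot_permutes]
    by (auto simp: face_succ_def inj_on_def inj_def)
  then have "bij_betw (face_succ rot) D D"
    unfolding bij_betw_def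
    by (intro conjI endo_inj_surj) (auto simp: face_succ_def simp del: split_paired_Ex intro: sym_D)
  then have "bij_betw s D D"
    by (rule bij_betw_cong[THEN iffD1, rotated]) (simp add: s_def)
  then have s: "s permutes D"
    by (rule bij_imp_permutes) (simp add: s_def)
  have eq: "L d = orbit s d"
    unfolding left_face_def
    using d by (intro orbit_cong0[of _ D]) (auto simp: s_def face_succ_def)
  show "L d \<subseteq> D"
    unfolding eq using permutes_orbit_subset[OF s d] .
  have cyc: "cyclic_on s (L d)"
    unfolding eq using cyclic_on_orbit[OF s] by simp
  have "permutation s"
    using s by (auto simp: permutation_permutes)
  then show "d \<in> L d"
    unfolding eq by (rule permutation_self_in_orbit)
  show "cyclic_on (face_succ rot) (L d)"
    using cyclic_cong[of "L d" s "face_succ rot"] cyc \<open>L d \<subseteq> D\<close>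
    by (auto simp: s_def subset_iff)
qed

lemma left_face_eq:
  assumes "d \<in> D" "e \<in> L d"
  shows "L e = L d"
  using orbit_cyclic_eq3[OF cyclic_left_face[OF assms(1)] assms(2)]
  by (simp add: left_face_def)

lemma left_face_in_F [simp]: "d \<in> D \<Longrightarrow> L d \<in> F"
  by (simp add: faces_def)

lemma in_face_iff: "f \<in> F \<Longrightarrow> d \<in> f \<longleftrightarrow> d \<in> D \<and> L d = f"
  unfolding faces_def using left_face_eq left_face_subset self_in_left_face by blast

lemma face_nonempty:
  assumes "f \<in> F"
  obtains d where "d \<in> D" "L d = f"
  using assms by (auto simp: faces_def)

lemma outer_in_F [simp]: "outer \<in> F"
  using plane by (simp add: plane_graph_def)

text \<open>\<open>rot d\<close> follows the reverse of \<open>d\<close> on a face walk. Turning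
  clockwise from \<open>d\<close> to \<open>rot d\<close> thus means crossing the edge of
  \<open>d\<close>, and \<open>L d\<close> is the face of the corner just before
  \<open>d\<close>.\<close>

lemma left_face_rot [simp]: "d \<in> D \<Longrightarrow> L (rot d) = L (prod.swap d)"
proof -
  assume d: "d \<in> D"
  have "rot d = face_succ rot (prod.swap d)"
    by (simp add: face_succ_def)
  moreover have "face_succ rot (prod.swap d) \<in> L (prod.swap d)"
    unfolding left_face_def by (rule orbit.base)
  ultimately show ?thesis
    using left_face_eq[of "prod.swap d" "rot d"] d by simp
qed

lemma edge_of_swap [simp]: "edge_of (prod.swap d) = edge_of d"
  by (auto simp: edge_of_def)

lemma edge_of_eq_iff: "edge_of d = edge_of e \<longleftrightarrow> d = e \<or> d = prod.swap e"
  by (cases d; cases e) (auto simp: edge_of_def doubleton_eq_iff)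

lemma edge_of_in_E [simp]: "d \<in> D \<Longrightarrow> edge_of d \<in> E"
  by (simp add: edges_def)

text \<open>Without loops each edge at \<open>v\<close> has exactly one dart leaving
  \<open>v\<close>, so degrees can be counted along the rotation.\<close>

lemma card_edges_at:
  assumes "S \<subseteq> E"
  shows "card {e \<in> S. v \<in> e} = card {d \<in> out_darts v. edge_of d \<in> S}"
proof -
  have "inj_on edge_of {d \<in> out_darts v. edge_of d \<in> S}"
    using no_loop by (fastforce simp: inj_on_def edge_of_eq_iff out_darts_def)
  moreover have "edge_of ` {d \<in> out_darts v. edge_of d \<in> S} = {e \<in> S. v \<in> e}"
  proof (intro equalityI subsetI)
    fix e assume "e \<in> {e \<in> S. v \<in> e}"
    with assms obtain d where d: "d \<in> D" "e = edge_of d" "v \<in> edge_of d" "e \<in> S"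
      by (auto simp: edges_def)
    show "e \<in> edge_of ` {d \<in> out_darts v. edge_of d \<in> S}"
    proof (cases "fst d = v")
      case True
      with d show ?thesis by (auto simp: out_darts_def)
    next
      case False
      with d(3) have "snd d = v"
        by (auto simp: edge_of_def)
      with d have "prod.swap d \<in> {d \<in> out_darts v. edge_of d \<in> S}"
        by (simp add: out_darts_def)
      then show ?thesis
        by (rule rev_image_eqI) (simp add: d(2))
    qed
  next
    fix e assume "e \<in> edge_of ` {d \<in> out_darts v. edge_of d \<in> S}"
    then obtain d where "d \<in> out_darts v" "e = edge_of d" "edge_of d \<in> S"
      by blast
    then show "e \<in> {e \<in> S. v \<in> e}"
      by (simp add: edge_of_def out_darts_def)
  qed
  ultimately show ?thesis using card_image by fastforce
qed

subsection \<open>The cycle space modulo 2\<close>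

definition odd_at :: "'a set set \<Rightarrow> 'a \<Rightarrow> bool" where
  "odd_at S v \<longleftrightarrow> odd (card {e \<in> S. v \<in> e})"

text \<open>The kernel of the incidence map over the two-element field, with symmetric difference as
  addition.\<close>

definition cycle_space :: "'a set set set" where
  "cycle_space = {S. S \<subseteq> E \<and> (\<forall>v \<in> V. \<not> odd_at S v)}"

text \<open>The sum modulo 2 of the boundary walks of the faces in \<open>X\<close>; an edge with
  the same face on both sides cancels.\<close>

definition boundary :: "'a face set \<Rightarrow> 'a set set" where
  "boundary X = edge_of ` {d \<in> D. (L d \<in> X) \<noteq> (L (prod.swap d) \<in> X)}"

lemma odd_at_sym_diff:
  assumes "finite S" "finite T"
  shows "odd_at (sym_diff S T) v \<longleftrightarrow> odd_at S v \<noteq> odd_at T v"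
proof -
  have "{e \<in> sym_diff S T. v \<in> e} = sym_diff {e \<in> S. v \<in> e} {e \<in> T. v \<in> e}"
    by auto
  with assms show ?thesis
    by (simp add: odd_at_def odd_card_sym_diff)
qed

lemma odd_at_edge: "odd_at {edge_of d} v \<longleftrightarrow> v = fst d \<or> v = snd d"
proof -
  have "{e \<in> {edge_of d}. v \<in> e} = (if v = fst d \<or> v = snd d then {edge_of d} else {})"
    by (auto simp: edge_of_def)
  then show ?thesis by (simp add: odd_at_def)
qed

lemma finite_subset_E: "S \<subseteq> E \<Longrightarrow> finite S"
  by (rule finite_subset) auto

lemma edge_of_in_boundary:
  "d \<in> D \<Longrightarrow> edge_of d \<in> boundary X \<longleftrightarrow> (L d \<in> X) \<noteq> (L (prod.swap d) \<in> X)"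
  by (cases d) (auto simp: boundary_def edge_of_eq_iff image_iff)

lemma boundary_subset: "boundary X \<subseteq> E"
  by (auto simp: boundary_def)

text \<open>At a vertex the boundary edges are those whose two adjacent corners differ in
  membership; as \<open>rot\<close> permutes the darts there, the two sets being added have equal
  size.\<close>

lemma boundary_in_cycle_space: "boundary X \<in> cycle_space"
proof -
  have "\<not> odd_at (boundary X) v" for v
  proof -
    have "{d \<in> out_darts v. edge_of d \<in> boundary X} =
        sym_diff {d \<in> out_darts v. L d \<in> X} {d \<in> out_darts v. L (rot d) \<in> X}"
      by (auto simp: edge_of_in_boundary out_darts_def)
    then show ?thesis
      by (simp add: odd_at_def card_edges_at[OF boundary_subset] odd_card_sym_diff
          card_rot_eq[of v "\<lambda>d. L d \<in> X"])
  qed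
  then show ?thesis
    by (auto simp: cycle_space_def boundary_subset)
qed

text \<open>A step in one direction suffices, because the darts at a vertex form a single cycle of
  \<open>rot\<close>.\<close>

lemma closed_under_rot:
  assumes "d \<in> D" "e \<in> D" "fst e = fst d" "P d"
    and step: "\<And>e. e \<in> D \<Longrightarrow> fst e = fst d \<Longrightarrow> P e \<Longrightarrow> P (rot e)"
  shows "P e"
proof -
  have "e \<in> orbit rot d"
    using orbit_cyclic_eq3[OF cyclic_rot[of "fst d"], of d] assms dart_verts
    by (auto simp: out_darts_def)
  then show ?thesis
  proof (induction rule: orbit.induct)
    case base
    show ?case using assms(1) refl assms(4) by (rule step)
  next
    case (step y)
    then have "y \<in> out_darts (fst d)"
      using orbit_cyclic_eq3[OF cyclic_rot[of "fst d"], of d] assms(1) dart_verts(1)[OF assms(1)]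
      by (simp add: out_darts_def)
    with step(2) show ?case by (simp add: out_darts_def assms(5))
  qed
qed

lemma connected_vertex_induct:
  assumes "u \<in> V" "P u" "\<And>d. d \<in> D \<Longrightarrow> P (fst d) \<Longrightarrow> P (snd d)" "v \<in> V"
  shows "P v"
proof -
  have "{w \<in> V. P w} = verts (with_proj G)"
  proof (rule connected_closed_set[of _ _ u])
    show "Digraph_Component.connected (with_proj G)"
      using plane by (simp add: plane_graph_def)
    fix d assume "d \<in> arcs (with_proj G)"
    then have d: "d \<in> D" by simp
    then have "P (fst d) \<longleftrightarrow> P (snd d)"
      using assms(3)[of d] assms(3)[of "prod.swap d"] by auto
    with d show "tail (with_proj G) d \<in> {w \<in> V. P w} \<longleftrightarrow> head (with_proj G) d \<in> {w \<in> V. P w}"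
      by (simp add: dart_verts)
  qed (use assms in auto)
  with assms(4) show ?thesis by auto
qed

text \<open>Crossing edges spreads membership to all corners at a vertex, and connectedness of the
  graph spreads it to all vertices.\<close>

lemma dual_connected:
  assumes "X \<subseteq> F" "X \<noteq> {}" and closed: "\<And>d. d \<in> D \<Longrightarrow> L d \<in> X \<Longrightarrow> L (prod.swap d) \<in> X"
  shows "X = F"
proof -
  obtain d where d: "d \<in> D" "L d \<in> X"
    using assms(1,2) unfolding faces_def by blast
  have rot: "L e' \<in> X" if "e \<in> D" "L e \<in> X" "e' \<in> D" "fst e' = fst e" for e e'
    using that closed by (intro closed_under_rot[of e e' "\<lambda>d. L d \<in> X"]) auto
  have "\<forall>e \<in> out_darts v. L e \<in> X" if "v \<in> V" for v
    using _ _ _ that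
  proof (rule connected_vertex_induct[where P = "\<lambda>v. \<forall>e \<in> out_darts v. L e \<in> X"])
    show "fst d \<in> V" using d by (simp add: dart_verts)
    show "\<forall>e \<in> out_darts (fst d). L e \<in> X"
      using rot[OF d] by (auto simp: out_darts_def)
    fix e assume e: "e \<in> D" "\<forall>e \<in> out_darts (fst e). L e \<in> X"
    then have "L (prod.swap e) \<in> X"
      using closed[of e] by (cases e) (simp add: out_darts_def)
    then show "\<forall>e' \<in> out_darts (snd e). L e' \<in> X"
      using rot[of "prod.swap e"] e(1) by (auto simp: out_darts_def)
  qed
  then have "L e \<in> X" if "e \<in> D" for e
    using that dart_verts(1)[OF that] unfolding out_darts_def by blast
  with assms(1) show ?thesis by (auto simp: faces_def)
qed

text \<open>If the boundaries agree, crossing an edge preserves membership in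
  \<open>sym_diff X Y\<close>, which is then empty or all of \<open>F\<close>; leaving out
  \<open>f\<close> excludes the latter.\<close>

lemma boundary_inj:
  assumes "X \<subseteq> F - {f}" "Y \<subseteq> F - {f}" "f \<in> F" "boundary X = boundary Y"
  shows "X = Y"
proof (rule ccontr)
  assume "X \<noteq> Y"
  then have "sym_diff X Y = F"
  proof (intro dual_connected)
    fix d assume "d \<in> D" "L d \<in> sym_diff X Y"
    then show "L (prod.swap d) \<in> sym_diff X Y"
      using edge_of_in_boundary[of d X] edge_of_in_boundary[of d Y] assms(4) by auto
  qed (use assms in auto)
  with assms(1-3) show False by blast
qed

section \<open>Upper bound for the size of the cycle space\<close>

lemma prescribed_parity:
  assumes "r \<in> V" "U \<subseteq> V - {r}"
  shows "\<exists>S \<subseteq> E. \<forall>v \<in> V - {r}. odd_at S v \<longleftrightarrow> v \<in> U"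
proof -
  \<comment> \<open>An edge set joining the root \<open>r\<close> to \<open>u\<close> is odd only at
    \<open>u\<close> among the other vertices, and appending an edge moves the odd vertex. General
    \<open>U\<close> arise as sums of such sets.\<close>
  have path: "\<exists>S \<subseteq> E. \<forall>v \<in> V - {r}. odd_at S v \<longleftrightarrow> v = u" if "u \<in> V" for u
    using \<open>r \<in> V\<close> _ _ that
  proof (rule connected_vertex_induct)
    show "\<exists>S \<subseteq> E. \<forall>v \<in> V - {r}. odd_at S v \<longleftrightarrow> v = r"
      by (intro exI[of _ "{}"]) (auto simp: odd_at_def)
    fix d assume d: "d \<in> D"
    assume "\<exists>S \<subseteq> E. \<forall>v \<in> V - {r}. odd_at S v \<longleftrightarrow> v = fst d"
    then obtain S where S: "S \<subseteq> E" "\<forall>v \<in> V - {r}. odd_at S v \<longleftrightarrow> v = fst d"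
      by blast
    show "\<exists>S \<subseteq> E. \<forall>v \<in> V - {r}. odd_at S v \<longleftrightarrow> v = snd d"
      using S d no_loop[OF d]
      by (intro exI[of _ "sym_diff S {edge_of d}"])
        (auto simp: odd_at_sym_diff finite_subset_E odd_at_edge)
  qed
  have "finite U"
    using assms(2) by (rule finite_subset) simp
  then show ?thesis
    using assms(2)
  proof induction
    case empty
    show ?case by (intro exI[of _ "{}"]) (auto simp: odd_at_def)
  next
    case (insert u U)
    then obtain S where S: "S \<subseteq> E" "\<forall>v \<in> V - {r}. odd_at S v \<longleftrightarrow> v \<in> U"
      by auto
    obtain T where T: "T \<subseteq> E" "\<forall>v \<in> V - {r}. odd_at T v \<longleftrightarrow> v = u"
      using path[of u] insert by auto
    show ?case
      using S T insert
      by (intro exI[of _ "sym_diff S T"]) (auto simp: odd_at_sym_diff finite_subset_E)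
  qed
qed

text \<open>Rank-nullity by counting: \<open>T U\<close> is a chosen edge set with parity pattern
  \<open>U\<close> away from \<open>r\<close>, and \<open>sym_diff K (T U)\<close> determines
  \<open>U\<close> by its parities and then \<open>K\<close>.\<close>

lemma card_cycle_space_le: "card cycle_space * 2 ^ (card V - 1) \<le> 2 ^ card E"
proof -
  obtain d where "d \<in> D"
    using face_nonempty[OF outer_in_F] by blast
  then obtain r where r: "r \<in> V"
    using dart_verts by blast
  define T where "T U = (SOME S. S \<subseteq> E \<and> (\<forall>v \<in> V - {r}. odd_at S v \<longleftrightarrow> v \<in> U))" for U
  have T: "T U \<subseteq> E" "\<And>v. v \<in> V - {r} \<Longrightarrow> odd_at (T U) v \<longleftrightarrow> v \<in> U" if "U \<subseteq> V - {r}" for U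
    using someI_ex[OF prescribed_parity[OF r that]] unfolding T_def by blast+
  let ?h = "\<lambda>(K, U). sym_diff K (T U)"
  have fin: "finite cycle_space"
    by (rule finite_subset[of _ "Pow E"]) (auto simp: cycle_space_def)
  have "inj_on ?h (cycle_space \<times> Pow (V - {r}))"
  proof (rule inj_onI, clarify)
    fix K U K' U'
    assume K: "K \<in> cycle_space" "K' \<in> cycle_space" and U: "U \<subseteq> V - {r}" "U' \<subseteq> V - {r}"
      and eq: "sym_diff K (T U) = sym_diff K' (T U')"
    have "v \<in> U \<longleftrightarrow> v \<in> U'" if v: "v \<in> V - {r}" for v
    proof -
      have "odd_at (sym_diff K (T U)) v \<longleftrightarrow> v \<in> U"
        using K U v T[OF U(1)]
        by (subst odd_at_sym_diff) (auto simp: cycle_space_def finite_subset_E)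
      moreover have "odd_at (sym_diff K' (T U')) v \<longleftrightarrow> v \<in> U'"
        using K U v T[OF U(2)]
        by (subst odd_at_sym_diff) (auto simp: cycle_space_def finite_subset_E)
      ultimately show ?thesis using eq by simp
    qed
    with U have "U = U'" by blast
    with eq show "K = K' \<and> U = U'" by blast
  qed
  moreover have "?h ` (cycle_space \<times> Pow (V - {r})) \<subseteq> Pow E"
  proof (clarsimp)
    fix K U e assume "K \<in> cycle_space" "U \<subseteq> V - {r}" "e \<in> K \<and> e \<notin> T U \<or> e \<in> T U \<and> e \<notin> K"
    with T(1) show "e \<in> E" by (auto simp: cycle_space_def)
  qed
  ultimately have "card (cycle_space \<times> Pow (V - {r})) \<le> card (Pow E)"
    by (intro card_inj_on_le) auto
  then show ?thesis
    using r fin by (simp add: card_cartesian_product card_Pow)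
qed

text \<open>
  The boundaries of face sets avoiding \<open>outer\<close> number \<open>2 ^ (card F - 1)\<close>, which by Euler's formula
  is the largest possible size of the cycle space.
\<close>

theorem cycle_space_boundary:
  assumes "S \<in> cycle_space"
  obtains X where "X \<subseteq> F - {outer}" "S = boundary X"
proof -
  have euler: "int (card V) - int (card E) + int (card F) = 2"
    using plane by (simp add: plane_graph_def)
  have fin: "finite cycle_space"
    by (rule finite_subset[of _ "Pow E"]) (auto simp: cycle_space_def)
  have "V \<noteq> {}"
    using face_nonempty[OF outer_in_F] dart_verts by blast
  then have V: "card V \<ge> 1"
    by (simp add: Suc_le_eq card_gt_0_iff)
  have F: "card F \<ge> 1"
    using outer_in_F finite_F by (metis One_nat_def Suc_le_eq card_gt_0_iff empty_iff)
  have "inj_on boundary (Pow (F - {outer}))"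
    using boundary_inj[of _ outer] by (intro inj_onI) auto
  then have card: "card (boundary ` Pow (F - {outer})) = 2 ^ (card F - 1)"
    by (simp add: card_image card_Pow)
  have "card E = (card F - 1) + (card V - 1)"
    using euler V F by linarith
  then have "card cycle_space * 2 ^ (card V - 1) \<le> 2 ^ (card F - 1) * 2 ^ (card V - 1)"
    using card_cycle_space_le by (simp add: power_add)
  then have "card cycle_space \<le> card (boundary ` Pow (F - {outer}))"
    by (simp add: card)
  then have "boundary ` Pow (F - {outer}) = cycle_space"
    using fin boundary_in_cycle_space by (intro card_seteq) auto
  with assms that show thesis by blast
qed

text \<open>Each turn crosses the edge of the current dart, so membership in \<open>X\<close> flips
  exactly at boundary edges.\<close>

lemma segment_parity:
  assumes "d \<in> D"
  shows "odd (card {i. i < n \<and> edge_of ((rot ^^ i) d) \<in> boundary X}) \<longleftrightarrow>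
    (L d \<in> X) \<noteq> (L ((rot ^^ n) d) \<in> X)"
proof (induction n)
  case (Suc n)
  have "{i. i < Suc n \<and> edge_of ((rot ^^ i) d) \<in> boundary X} =
    {i. i < n \<and> edge_of ((rot ^^ i) d) \<in> boundary X} \<union>
    (if edge_of ((rot ^^ n) d) \<in> boundary X then {n} else {})"
    by (auto simp: less_Suc_eq)
  with Suc funpow_rot_in_D[OF assms, of n] show ?case
    by (auto simp: edge_of_in_boundary)
qed simp

lemma edge_of_eq_same_tail:
  "d \<in> D \<Longrightarrow> e \<in> D \<Longrightarrow> fst d = fst e \<Longrightarrow> edge_of d = edge_of e \<longleftrightarrow> d = e"
  using no_loop[of e] by (auto simp: edge_of_eq_iff)

end

section \<open>Two-connected plane graphs\<close>

locale two_connected_plane = plane_rotation_system +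
  assumes two_connected: "two_connected G"
begin

text \<open>\<open>S\<close> plays the part of a path from \<open>a\<close> to \<open>b\<close> in
  the connected graph left after deleting \<open>v\<close>, built edge by edge.\<close>

lemma odd_set_avoiding_vertex:
  assumes "v \<in> V" "a \<in> V - {v}" "b \<in> V - {v}"
  shows "\<exists>S \<subseteq> E. (\<forall>e \<in> S. v \<notin> e) \<and> (\<forall>w \<in> V. odd_at S w \<longleftrightarrow> (w = a) \<noteq> (w = b))"
proof -
  define P where
    "P u S \<longleftrightarrow> S \<subseteq> E \<and> (\<forall>e \<in> S. v \<notin> e) \<and> (\<forall>w \<in> V. odd_at S w \<longleftrightarrow> (w = a) \<noteq> (w = u))" for u S
  let ?H = "pre_digraph.del_vert (with_proj G) v"
  have step: "\<exists>S. P (snd d) S" if d: "d \<in> D" "v \<noteq> fst d" "v \<noteq> snd d" and "P (fst d) S" for d S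
  proof -
    have S: "S \<subseteq> E" "\<forall>e \<in> S. v \<notin> e" "\<forall>w \<in> V. odd_at S w \<longleftrightarrow> (w = a) \<noteq> (w = fst d)"
      using that(4) by (simp_all add: P_def)
    have "v \<notin> edge_of d"
      using d by (simp add: edge_of_def)
    then have "\<forall>e \<in> sym_diff S {edge_of d}. v \<notin> e"
      using S(2) by blast
    moreover have "sym_diff S {edge_of d} \<subseteq> E"
      using S(1) edge_of_in_E[OF d(1)] by blast
    moreover have "odd_at (sym_diff S {edge_of d}) w \<longleftrightarrow> (w = a) \<noteq> (w = snd d)" if "w \<in> V" for w
    proof -
      have "odd_at (sym_diff S {edge_of d}) w \<longleftrightarrow> odd_at S w \<noteq> (w = fst d \<or> w = snd d)"
        using finite_subset_E[OF S(1)] by (subst odd_at_sym_diff) (simp_all add: odd_at_edge)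
      moreover have "odd_at S w \<longleftrightarrow> (w = a) \<noteq> (w = fst d)"
        using S(3) that by blast
      ultimately show ?thesis
        using no_loop[OF d(1)] by metis
    qed
    ultimately have "P (snd d) (sym_diff S {edge_of d})"
      by (simp add: P_def)
    then show ?thesis ..
  qed
  have "{u \<in> V - {v}. \<exists>S. P u S} = verts ?H"
  proof (rule connected_closed_set[of _ _ a])
    show "Digraph_Component.connected ?H"
      using two_connected assms(1) by (simp add: two_connected_def)
    have "P a {}"
      by (auto simp: P_def odd_at_def)
    with assms(2) show "a \<in> {u \<in> V - {v}. \<exists>S. P u S}"
      by blast
    fix d assume "d \<in> arcs ?H"
    then have d: "d \<in> D" "v \<noteq> fst d" "v \<noteq> snd d"
      by (auto simp: pre_digraph.del_vert_simps)
    then have "(\<exists>S. P (fst d) S) \<longleftrightarrow> (\<exists>S. P (snd d) S)"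
      using step[of d] step[of "prod.swap d"] by auto
    with d show "tail ?H d \<in> {u \<in> V - {v}. \<exists>S. P u S} \<longleftrightarrow> head ?H d \<in> {u \<in> V - {v}. \<exists>S. P u S}"
      by (auto simp: pre_digraph.del_vert_simps dart_verts)
  qed (auto simp: pre_digraph.del_vert_simps)
  with assms(3) show ?thesis
    unfolding P_def by (auto simp: pre_digraph.del_vert_simps)
qed

text \<open>
  If a face had two corners at \<open>v\<close>, they would split the darts at \<open>v\<close> into two segments.  A cycle
  through \<open>v\<close> using one dart of each segment is a boundary of a set of faces, hence crosses each
  segment an even number of times.
\<close>

theorem face_corner_unique:
  assumes d: "d \<in> D" and d': "d' \<in> D" and tail: "fst d = fst d'" and face: "L d = L d'"
  shows "d = d'"
proof (rule ccontr)
  assume neq: "d \<noteq> d'"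
  define v where "v = fst d"
  have v: "v \<in> V" "fst d = v" "fst d' = v"
    using dart_verts(1)[OF d] tail by (auto simp: v_def)
  have ab: "snd d \<in> V - {v}" "snd d' \<in> V - {v}"
    using d d' v no_loop[of d] no_loop[of d'] by (auto simp: dart_verts)
  obtain S where S: "S \<subseteq> E" "\<forall>e \<in> S. v \<notin> e"
    "\<forall>w \<in> V. odd_at S w \<longleftrightarrow> (w = snd d) \<noteq> (w = snd d')"
    using odd_set_avoiding_vertex[OF v(1) ab] by blast
  define Z where "Z = sym_diff S (sym_diff {edge_of d} {edge_of d'})"
  have "odd_at Z w \<longleftrightarrow> odd_at S w \<noteq> (odd_at {edge_of d} w \<noteq> odd_at {edge_of d'} w)" for w
    unfolding Z_def
    by (subst odd_at_sym_diff, (simp add: finite_subset_E[OF S(1)])+,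
        subst odd_at_sym_diff) simp_all
  then have "\<forall>w \<in> V. \<not> odd_at Z w"
    using S(3) ab v by (auto simp: odd_at_edge)
  then have "Z \<in> cycle_space"
    using S(1) d d' by (auto simp: cycle_space_def Z_def)
  then obtain X where X: "Z = boundary X"
    by (rule cycle_space_boundary)
  have "d' \<in> orbit rot d"
    using orbit_cyclic_eq3[OF cyclic_rot[OF v(1)], of d] d d' v by (simp add: out_darts_def)
  then obtain n where n: "(rot ^^ n) d = d'" "n > 0" "\<And>i. i < n \<Longrightarrow> (rot ^^ i) d \<noteq> d'"
    "inj_on (\<lambda>i. (rot ^^ i) d) {..n}"
    using orbit_least_exponent[OF _ neq] by blast
  \<comment> \<open>On the segment from \<open>d\<close> up to but excluding \<open>d'\<close>, only
    the edge of \<open>d\<close> belongs to \<open>Z\<close>, as \<open>S\<close> avoids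
    \<open>v\<close>. A single crossing is incompatible with \<open>L d = L d'\<close>.\<close>
  have "edge_of ((rot ^^ i) d) \<in> Z \<longleftrightarrow> i = 0" if i: "i < n" for i
  proof -
    let ?e = "(rot ^^ i) d"
    have e: "?e \<in> D" "fst ?e = v"
      using funpow_rot_in_D[OF d, of i] v by auto
    then have "edge_of ?e \<notin> S"
      using S(2) by (auto simp: edge_of_def)
    moreover have "edge_of ?e \<noteq> edge_of d'"
      using edge_of_eq_same_tail[of ?e d'] e d' v n(3)[OF i] by simp
    moreover have "edge_of ?e = edge_of d \<longleftrightarrow> i = 0"
    proof -
      have "?e = d \<longleftrightarrow> i = 0"
        using inj_on_eq_iff[OF n(4), of i 0] i by simp
      with edge_of_eq_same_tail[of ?e d] e d v(2) show ?thesis by simp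
    qed
    ultimately show ?thesis by (auto simp: Z_def)
  qed
  then have "{i. i < n \<and> edge_of ((rot ^^ i) d) \<in> boundary X} = {0}"
    using n(2) X by auto
  then show False
    using segment_parity[OF d, of n X] n(1) face by simp
qed

section \<open>Facial walks are cycles\<close>

lemma rot_neq:
  assumes d: "d \<in> D"
  shows "rot d \<noteq> d"
proof
  assume "rot d = d"
  \<comment> \<open>A fixed point of \<open>rot\<close> makes \<open>fst d\<close> a vertex of
    degree one. Deleting its sole neighbour \<open>snd d\<close> isolates it, and connectedness
    leaves just two vertices.\<close>
  then have only: "e = d" if "e \<in> D" "fst e = fst d" for e
    using that d by (intro closed_under_rot[of d e "\<lambda>e. e = d"]) auto
  let ?H = "pre_digraph.del_vert (with_proj G) (snd d)"
  have "{fst d} = verts ?H"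
  proof (rule connected_closed_set)
    show "Digraph_Component.connected ?H"
      using two_connected d dart_verts by (simp add: two_connected_def)
    fix e assume "e \<in> arcs ?H"
    then have e: "e \<in> D" "fst e \<noteq> snd d" "snd e \<noteq> snd d"
      by (auto simp: pre_digraph.del_vert_simps)
    show "tail ?H e \<in> {fst d} \<longleftrightarrow> head ?H e \<in> {fst d}"
    proof -
      have "fst e \<noteq> fst d"
        using only[OF e(1)] e(3) by blast
      moreover have "snd e \<noteq> fst d"
      proof
        assume "snd e = fst d"
        then have "prod.swap e = d"
          using only[of "prod.swap e"] e(1) by simp
        with e(2) show False by auto
      qed
      ultimately show ?thesis
        by (simp add: pre_digraph.del_vert_simps)
    qed
  qed (use d no_loop[OF d] in \<open>auto simp: pre_digraph.del_vert_simps dart_verts\<close>)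
  then have "V = {fst d, snd d}"
    using dart_verts[OF d] by (auto simp: pre_digraph.del_vert_simps)
  then have "card V \<le> 2"
    by (simp add: card_insert_if)
  with two_connected show False
    by (simp add: two_connected_def)
qed

text \<open>The face across the edge is \<open>L (rot d)\<close>; equality would give one face two
  corners at \<open>fst d\<close>.\<close>

lemma left_face_neq_swap:
  assumes "d \<in> D"
  shows "L d \<noteq> L (prod.swap d)"
  using face_corner_unique[of d "rot d"] rot_neq[of d] assms by auto

lemma facial_cycle:
  assumes "f \<in> F"
  shows "is_facial_cycle f"
proof -
  obtain d where d: "d \<in> D" "L d = f"
    using face_nonempty[OF assms] .
  let ?s = "face_succ rot"
  have s: "?s e \<in> D \<and> L (?s e) = L e" if "e \<in> D" for e
    using that by (simp add: face_succ_def)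
  have fst_s: "fst (?s e) = snd e" if "e \<in> D" for e
    using that by (simp add: face_succ_def)
  have in_f: "d \<in> f" "?s d \<in> f" "?s (?s d) \<in> f"
    using assms d s by (auto simp: in_face_iff)
  \<comment> \<open>A boundary walk of length two would return along the same edge, so
    \<open>rot\<close> would fix the reverse of \<open>d\<close>.\<close>
  have "?s (?s d) \<noteq> d"
  proof
    assume eq: "?s (?s d) = d"
    have "snd (?s d) = fst (?s (?s d))"
      using fst_s[of "?s d"] s[OF d(1)] by simp
    with eq have "?s d = prod.swap d"
      using fst_s[OF d(1)] by (auto simp: prod_eq_iff)
    then show False
      using rot_neq[of "prod.swap d"] d(1) by (simp add: face_succ_def)
  qed
  moreover have "?s e \<noteq> e" if "e \<in> D" for e
    using fst_s[OF that] no_loop[OF that] by auto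
  ultimately have "card {d, ?s d, ?s (?s d)} = 3"
    using d(1) s by (metis card_3_iff)
  moreover have "finite f"
    using assms finite_D by (rule_tac finite_subset[of f D]) (auto simp: in_face_iff)
  ultimately have "card f \<ge> 3"
    using card_mono[of f "{d, ?s d, ?s (?s d)}"] in_f by simp
  moreover have "inj_on fst f"
    using assms face_corner_unique by (intro inj_onI) (auto simp: in_face_iff simp del: split_paired_All)
  ultimately show ?thesis
    by (simp add: is_facial_cycle_def)
qed

end

section \<open>Two-connected outerplane bipartite graphs\<close>

locale outerplane_bipartite = two_connected_plane +
  fixes c :: "'a \<Rightarrow> color"
  assumes all_outer: "v \<in> V \<Longrightarrow> \<exists>d \<in> outer. fst d = v"
    and coloring: "proper_coloring G c"
begin

abbreviation "inner \<equiv> inner_faces G rot outer"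
abbreviation "white d \<equiv> c (fst d) = White"
abbreviation "ideals \<equiv> order_ideals (face_poset G rot outer c)"

lemma white_snd [simp]: "d \<in> D \<Longrightarrow> c (snd d) = White \<longleftrightarrow> \<not> white d"
proof -
  assume "d \<in> D"
  then have "c (fst d) \<noteq> c (snd d)"
    using coloring by (auto simp: proper_coloring_def)
  then show ?thesis
    by (cases "c (fst d)"; cases "c (snd d)") auto
qed

lemma white_swap: "d \<in> D \<Longrightarrow> white (prod.swap d) \<longleftrightarrow> \<not> white d"
  by simp

lemma inner_iff: "f \<in> inner \<longleftrightarrow> f \<in> F \<and> f \<noteq> outer"
  by (auto simp: inner_faces_def)

lemma outer_dart:
  assumes "v \<in> V"
  obtains d where "d \<in> D" "fst d = v" "L d = outer"
proof -
  obtain d where "d \<in> outer" "fst d = v"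
    using all_outer[OF assms] by blast
  with that[of d] in_face_iff[OF outer_in_F, of d] show thesis by simp
qed

lemma card_outer_corners:
  assumes "v \<in> V"
  shows "card {d \<in> out_darts v. L d = outer} = 1"
proof -
  obtain d where d: "d \<in> D" "fst d = v" "L d = outer"
    using outer_dart[OF assms] .
  have "{d \<in> out_darts v. L d = outer} = {d}"
  proof (intro equalityI subsetI)
    fix e assume "e \<in> {d \<in> out_darts v. L d = outer}"
    then show "e \<in> {d}"
      using face_corner_unique[of e d] d by (simp add: out_darts_def)
  qed (use d in \<open>simp add: out_darts_def\<close>)
  then show ?thesis by simp
qed

subsection \<open>The inner dual is a tree\<close>

text \<open>Without the single outer corner, the corners at a vertex form a row starting at
  \<open>rot d\<close>. Neighbours in it are separated by an edge between two inner faces, so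
  membership in \<open>K\<close> is constant along the row.\<close>

lemma inner_corners_closed:
  assumes closed: "\<And>d. d \<in> D \<Longrightarrow> L d \<in> K \<Longrightarrow> L (prod.swap d) \<in> inner \<Longrightarrow> L (prod.swap d) \<in> K"
    and K: "K \<subseteq> inner"
    and d: "d \<in> D" "L d = outer" and e: "e \<in> D" "fst e = fst d" "L e \<noteq> outer"
  shows "L e \<in> K \<longleftrightarrow> L (prod.swap d) \<in> K"
proof -
  have only: "e' = d" if "e' \<in> D" "fst e' = fst d" "L e' = outer" for e'
    using face_corner_unique[OF that(1) d(1) that(2)] that(3) d(2) by simp
  have rot: "L (prod.swap d) = L (rot d)"
    using d by simp
  show ?thesis
  proof (cases "L (prod.swap d) \<in> K")
    case True
    \<comment> \<open>\<open>closed_under_rot\<close> goes all the way round, so the invariant has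
      to tolerate the outer corner.\<close>
    have "L e = outer \<or> L e \<in> K"
    proof (rule closed_under_rot[of "rot d" e "\<lambda>e. L e = outer \<or> L e \<in> K"])
      fix e' assume e': "e' \<in> D" "fst e' = fst (rot d)" "L e' = outer \<or> L e' \<in> K"
      show "L (rot e') = outer \<or> L (rot e') \<in> K"
      proof (cases "L e' = outer")
        case outer: True
        then have "e' = d"
          using only[of e'] e' d by simp
        with True d show ?thesis by simp
      next
        case False
        with e' closed[of e'] show ?thesis
          by (auto simp: inner_iff)
      qed
    qed (use True d e in auto)
    with True e show ?thesis by simp
  next
    case False
    have "L e \<notin> K"
    proof (rule closed_under_rot[of "rot d" e "\<lambda>e. L e \<notin> K"])
      fix e' assume e': "e' \<in> D" "fst e' = fst (rot d)" "L e' \<notin> K"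
      show "L (rot e') \<notin> K"
      proof (cases "L e' = outer")
        case outer: True
        then have "e' = d"
          using only[of e'] e' d by simp
        with False d show ?thesis by simp
      next
        case False
        with e' closed[of "prod.swap e'"] show ?thesis
          by (auto simp: inner_iff)
      qed
    qed (use False d e in auto)
    with False show ?thesis by simp
  qed
qed

text \<open>Consecutive darts of the outer walk share a vertex, so the inner faces behind them agree
  on membership in \<open>K\<close>. Every vertex has an outer corner, so each inner face is
  compared with one of these.\<close>

lemma inner_dual_connected:
  assumes closed: "\<And>d. d \<in> D \<Longrightarrow> L d \<in> K \<Longrightarrow> L (prod.swap d) \<in> inner \<Longrightarrow> L (prod.swap d) \<in> K"
    and K: "K \<subseteq> inner" "K \<noteq> {}"
  shows "K = inner"
proof -
  obtain d0 where d0: "d0 \<in> D" "L d0 = outer"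
    using face_nonempty[OF outer_in_F] .
  have const: "L (prod.swap d) \<in> K \<longleftrightarrow> L (prod.swap d0) \<in> K" if "d \<in> D" "L d = outer" for d
  proof -
    have "d \<in> orbit (face_succ rot) d0"
      using in_face_iff[OF outer_in_F, of d] that d0 by (simp add: left_face_def)
    then have "d \<in> D \<and> L d = outer \<and> (L (prod.swap d) \<in> K \<longleftrightarrow> L (prod.swap d0) \<in> K)"
    proof (induction rule: orbit.induct)
      case base
      have "L (prod.swap d0) \<noteq> outer"
        using left_face_neq_swap[OF d0(1)] d0(2) by simp
      then show ?case
        using inner_corners_closed[OF closed K(1), of "face_succ rot d0" "prod.swap d0"] d0
        by (simp add: face_succ_def)
    next
      case (step e)
      have "L (prod.swap e) \<noteq> outer"
        using left_face_neq_swap[of e] step by simp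
      then show ?case
        using inner_corners_closed[OF closed K(1), of "face_succ rot e" "prod.swap e"] step
        by (simp add: face_succ_def)
    qed
    then show ?thesis by blast
  qed
  have all: "L e \<in> K \<longleftrightarrow> L (prod.swap d0) \<in> K" if e: "e \<in> D" "L e \<noteq> outer" for e
  proof -
    obtain d where d: "d \<in> D" "fst d = fst e" "L d = outer"
      using outer_dart[OF dart_verts(1)[OF e(1)]] .
    show ?thesis
      using inner_corners_closed[OF closed K(1) d(1,3) e(1) _ e(2)] const[OF d(1,3)] d(2) by simp
  qed
  have *: "\<exists>e \<in> D. L e = f \<and> L e \<noteq> outer" if "f \<in> inner" for f
    using that face_nonempty[of f] unfolding inner_iff by blast
  obtain f where "f \<in> K" using K by blast
  then have "L (prod.swap d0) \<in> K"
    using *[of f] K all by blast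
  then have "inner \<subseteq> K"
    using * all by blast
  with K show ?thesis by blast
qed

section \<open>Counting the edges of the inner dual\<close>

definition edges_within :: "'a face set \<Rightarrow> 'a set set" where
  "edges_within K = edge_of ` {d \<in> D. L d \<in> K \<and> L (prod.swap d) \<in> K}"

lemma edge_of_in_edges_within:
  "d \<in> D \<Longrightarrow> edge_of d \<in> edges_within K \<longleftrightarrow> L d \<in> K \<and> L (prod.swap d) \<in> K"
  by (cases d) (auto simp: edges_within_def edge_of_eq_iff image_iff)

lemma finite_edges_within [simp]: "finite (edges_within K)"
  by (simp add: edges_within_def)

text \<open>The outer boundary is a Hamiltonian cycle with \<open>card V\<close> edges. By Euler's
  formula the remaining edges number one less than the inner faces, as in a tree.\<close>

lemma card_edges_within_inner: "card (edges_within inner) + 1 = card inner"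
proof -
  have outer_sub: "outer \<subseteq> D"
    using in_face_iff[OF outer_in_F] by blast
  have "inj_on edge_of outer"
  proof (rule inj_onI)
    fix d e assume "d \<in> outer" "e \<in> outer" "edge_of d = edge_of e"
    then show "d = e"
      using left_face_neq_swap[of e] in_face_iff[OF outer_in_F] by (auto simp: edge_of_eq_iff)
  qed
  moreover have "inj_on fst outer"
    using facial_cycle[OF outer_in_F] by (simp add: is_facial_cycle_def)
  moreover have "fst ` outer = V"
    using all_outer dart_verts(1) outer_sub by blast
  ultimately have card_outer: "card (edge_of ` outer) = card V"
    by (metis card_image)
  have "E = edges_within inner \<union> edge_of ` outer"
  proof (intro equalityI subsetI)
    fix e assume "e \<in> E"
    then obtain d where d: "d \<in> D" "e = edge_of d"
      by (auto simp: edges_def)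
    then show "e \<in> edges_within inner \<union> edge_of ` outer"
    proof (cases "L d = outer \<or> L (prod.swap d) = outer")
      case True
      then have "d \<in> outer \<or> prod.swap d \<in> outer"
        using d(1) by (simp add: in_face_iff[OF outer_in_F])
      then have "edge_of d \<in> edge_of ` outer"
        using imageI[of d outer edge_of] imageI[of "prod.swap d" outer edge_of] by auto
      with d(2) show ?thesis by simp
    next
      case False
      with d show ?thesis
        by (simp add: edge_of_in_edges_within inner_iff)
    qed
  next
    fix e assume "e \<in> edges_within inner \<union> edge_of ` outer"
    then show "e \<in> E"
      using outer_sub by (auto simp: edges_within_def)
  qed
  moreover have "edges_within inner \<inter> edge_of ` outer = {}"
  proof -
    have "edge_of d \<notin> edges_within inner" if "d \<in> outer" for d
      using that in_face_iff[OF outer_in_F, of d] by (simp add: edge_of_in_edges_within inner_iff)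
    then show ?thesis by blast
  qed
  moreover have "finite outer"
    using outer_sub finite_D by (rule finite_subset)
  ultimately have "card E = card (edges_within inner) + card V"
    using card_outer by (simp add: card_Un_disjoint)
  moreover have "int (card V) - int (card E) + int (card F) = 2"
    using plane by (simp add: plane_graph_def)
  moreover have "card F = Suc (card inner)"
    unfolding inner_faces_def by (rule card.remove) auto
  ultimately show ?thesis by linarith
qed

text \<open>\<open>K\<close> is enlarged to \<open>inner\<close> face by face. Connectedness of the
  inner dual supplies a face adjacent to \<open>K\<close>, so each enlargement adds one face and at
  least one edge, while at the end faces outnumber edges by one.\<close>

lemma card_edges_within_less:
  assumes "K \<subseteq> inner" "K \<noteq> {}"
  shows "card (edges_within K) < card K"
  using assms
proof (induction "card (inner - K)" arbitrary: K rule: less_induct)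
  case less
  have fin: "finite inner"
    by (simp add: inner_faces_def)
  show ?case
  proof (cases "K = inner")
    case True
    with card_edges_within_inner show ?thesis by simp
  next
    case False
    then obtain d where d: "d \<in> D" "L d \<in> K" "L (prod.swap d) \<in> inner" "L (prod.swap d) \<notin> K"
      using inner_dual_connected[of K] less.prems by blast
    let ?K = "insert (L (prod.swap d)) K"
    have "card (edges_within ?K) < card ?K"
      using d less.prems fin by (intro less.hyps psubset_card_mono) auto
    moreover have "card ?K = Suc (card K)"
      using d finite_subset[OF less.prems(1) fin] by simp
    moreover have "insert (edge_of d) (edges_within K) \<subseteq> edges_within ?K"
      using d by (auto simp: edge_of_in_edges_within, auto simp: edges_within_def)
    then have "card (insert (edge_of d) (edges_within K)) \<le> card (edges_within ?K)"
      by (intro card_mono) auto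
    then have "Suc (card (edges_within K)) \<le> card (edges_within ?K)"
      using d by (simp add: edge_of_in_edges_within)
    ultimately show ?thesis by simp
  qed
qed

text \<open>
  Otherwise every face of \<open>K\<close> would have an arc into \<open>K\<close>; these arcs cross distinct edges, too many
  for a forest.
\<close>

lemma sink_face:
  assumes "K \<subseteq> inner" "K \<noteq> {}"
  obtains f where "f \<in> K" "\<And>d. d \<in> D \<Longrightarrow> white d \<Longrightarrow> L d = f \<Longrightarrow> L (prod.swap d) \<notin> K"
proof -
  have "\<exists>f \<in> K. \<forall>d \<in> D. white d \<longrightarrow> L d = f \<longrightarrow> L (prod.swap d) \<notin> K"
  proof (rule ccontr)
    assume "\<not> ?thesis"
    then have "\<forall>f \<in> K. \<exists>d. d \<in> D \<and> white d \<and> L d = f \<and> L (prod.swap d) \<in> K"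
      by blast
    then obtain a where a: "\<And>f. f \<in> K \<Longrightarrow> a f \<in> D \<and> white (a f) \<and> L (a f) = f \<and> L (prod.swap (a f)) \<in> K"
      by metis
    \<comment> \<open>Only one of the two darts of an edge has a white tail, so the edge determines
      the arc and its tail face.\<close>
    have "inj_on (\<lambda>f. edge_of (a f)) K"
    proof (rule inj_onI)
      fix f g assume fg: "f \<in> K" "g \<in> K" "edge_of (a f) = edge_of (a g)"
      then have "a f = a g"
        using a[OF fg(1)] a[OF fg(2)] white_swap[of "a g"] unfolding edge_of_eq_iff by metis
      with a[OF fg(1)] a[OF fg(2)] show "f = g" by metis
    qed
    moreover have "(\<lambda>f. edge_of (a f)) ` K \<subseteq> edges_within K"
      using a by (auto simp: edge_of_in_edges_within)
    ultimately have "card K \<le> card (edges_within K)"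
      by (intro card_inj_on_le) auto
    with card_edges_within_less[OF assms] show False by simp
  qed
  with that show thesis by blast
qed

subsection \<open>From ideals to perfect matchings and back\<close>

lemma verts_inner_dual: "verts (inner_dual G rot outer c) = inner"
  by (simp add: inner_dual_def oriented_dual_def pre_digraph.del_vert_simps inner_faces_def)

lemma arcs_ends_inner_dual:
  "arcs_ends (inner_dual G rot outer c) =
    (\<lambda>d. (L d, L (prod.swap d))) ` {d \<in> D. white d \<and> L d \<noteq> outer \<and> L (prod.swap d) \<noteq> outer}"
  by (simp add: inner_dual_def oriented_dual_def arcs_ends_conv pre_digraph.del_vert_simps conj_assoc)

lemma Field_face_poset: "Field (face_poset G rot outer c) = inner"
proof -
  have "(f, f) \<in> face_poset G rot outer c" if "f \<in> inner" for f
    using that by (simp add: face_poset_def reachable_def verts_inner_dual)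
  then show ?thesis
    unfolding Field_def by (fastforce simp: face_poset_def)
qed

text \<open>The order is generated by single dual arcs, each leading to a lower face, so closure
  need only be tested on them. Arcs into \<open>outer\<close> disappear with that vertex.\<close>

lemma ideal_iff:
  "I \<in> ideals \<longleftrightarrow> I \<subseteq> inner \<and>
    (\<forall>d \<in> D. white d \<longrightarrow> L d \<in> I \<longrightarrow> L (prod.swap d) \<noteq> outer \<longrightarrow> L (prod.swap d) \<in> I)"
    (is "_ \<longleftrightarrow> _ \<and> ?C")
proof -
  have "?C" if I: "I \<in> ideals"
  proof (intro ballI impI)
    fix d assume d: "d \<in> D" "white d" "L d \<in> I" "L (prod.swap d) \<noteq> outer"
    have "I \<subseteq> inner"
      using I by (simp add: order_ideals_def Field_face_poset)
    with d have inner: "L d \<in> inner" "L (prod.swap d) \<in> inner"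
      by (blast, simp add: inner_iff)
    then have "(L d, L (prod.swap d)) \<in> arcs_ends (inner_dual G rot outer c)"
      using d by (auto simp: arcs_ends_inner_dual inner_iff simp del: split_paired_Ex)
    then have "(L d, L (prod.swap d)) \<in> rtrancl_on inner (arcs_ends (inner_dual G rot outer c))"
      using inner by (meson rtrancl_on_into_rtrancl_on rtrancl_on_refl)
    then have "(L (prod.swap d), L d) \<in> face_poset G rot outer c"
      using inner by (simp add: face_poset_def reachable_def verts_inner_dual)
    with I d(3) show "L (prod.swap d) \<in> I"
      unfolding order_ideals_def by blast
  qed
  moreover have "I \<in> ideals" if I: "I \<subseteq> inner" "?C"
  proof -
    have "f \<in> I" if "(f, g) \<in> face_poset G rot outer c" "g \<in> I" for f g
    proof -
      have "(g, f) \<in> rtrancl_on inner (arcs_ends (inner_dual G rot outer c))"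
        using that(1) by (simp add: face_poset_def reachable_def verts_inner_dual)
      then show ?thesis
      proof (induction rule: rtrancl_on_induct)
        case (step y z)
        then obtain d where "d \<in> D" "white d" "L (prod.swap d) \<noteq> outer" "y = L d"
          "z = L (prod.swap d)"
          by (auto simp: arcs_ends_inner_dual)
        with step.IH I(2) show ?case by blast
      qed (use that in simp)
    qed
    with I(1) show ?thesis
      unfolding order_ideals_def Field_face_poset by blast
  qed
  moreover have "I \<subseteq> inner" if "I \<in> ideals"
    using that by (simp add: order_ideals_def Field_face_poset)
  ultimately show ?thesis by blast
qed

lemma outer_notin_ideal: "I \<in> ideals \<Longrightarrow> outer \<notin> I"
  by (auto simp: ideal_iff inner_iff)

text \<open>
  The edges crossed by the dual arcs that enter \<open>I\<close>, where \<open>outer\<close> counts as a member of \<open>I\<close> at the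
  head of an arc and as a non-member at its tail.
\<close>

definition matching_of :: "'a face set \<Rightarrow> 'a set set" where
  "matching_of I =
    edge_of ` {d \<in> D. white d \<and> L (prod.swap d) \<in> insert outer I \<and> L d \<notin> I}"

lemma edge_of_in_matching_of:
  assumes "d \<in> D" "white d"
  shows "edge_of d \<in> matching_of I \<longleftrightarrow> L (prod.swap d) \<in> insert outer I \<and> L d \<notin> I"
proof -
  have "e = d" if "e \<in> D" "white e" "edge_of d = edge_of e" for e
    using that assms white_swap[of e] unfolding edge_of_eq_iff by metis
  with assms show ?thesis
    unfolding matching_of_def by blast
qed

lemma edge_of_in_matching_of_int:
  assumes "I \<in> ideals" "d \<in> D" "white d"
  shows "of_bool (edge_of d \<in> matching_of I) =
    of_bool (L (prod.swap d) \<in> I) - of_bool (L d \<in> I) + (of_bool (L (prod.swap d) = outer) :: int)"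
  using assms(1)[unfolded ideal_iff] assms(2,3) outer_notin_ideal[OF assms(1)]
  by (auto simp: edge_of_in_matching_of)

lemma edge_of_in_matching_of_parity:
  assumes "I \<in> ideals" "d \<in> D" "white d"
  shows "edge_of d \<in> matching_of I \<longleftrightarrow>
    ((L (prod.swap d) \<in> I) \<noteq> (L d \<in> I)) \<noteq> (L (prod.swap d) = outer)"
  using assms(1)[unfolded ideal_iff] assms(2,3) outer_notin_ideal[OF assms(1)]
  by (auto simp: edge_of_in_matching_of)

lemma matching_of_subset: "matching_of I \<subseteq> E"
  by (auto simp: matching_of_def)

lemma perfect_matching_iff:
  "M \<in> perfect_matchings G \<longleftrightarrow> M \<subseteq> E \<and> (\<forall>v \<in> V. card {d \<in> out_darts v. edge_of d \<in> M} = 1)"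
proof -
  have "(\<exists>!e. e \<in> M \<and> v \<in> e) \<longleftrightarrow> card {e \<in> M. v \<in> e} = 1" for v
  proof
    assume "\<exists>!e. e \<in> M \<and> v \<in> e"
    then obtain e where "e \<in> M \<and> v \<in> e" "\<And>e'. e' \<in> M \<and> v \<in> e' \<Longrightarrow> e' = e"
      by (elim ex1E) blast
    then have "{e \<in> M. v \<in> e} = {e}"
      by blast
    then show "card {e \<in> M. v \<in> e} = 1" by simp
  next
    assume "card {e \<in> M. v \<in> e} = 1"
    then obtain e where "{e \<in> M. v \<in> e} = {e}"
      by (rule card_1_singletonE)
    then show "\<exists>!e. e \<in> M \<and> v \<in> e"
      by (intro ex1I[of _ e]) blast+
  qed
  then show ?thesis
    unfolding perfect_matchings_def using card_edges_at[of M] by auto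
qed

text \<open>
  Around a vertex the differences of the indicator function of \<open>I\<close> telescope, so that only the
  contribution of the unique outer corner remains.
\<close>

lemma matching_of_perfect:
  assumes I: "I \<in> ideals"
  shows "matching_of I \<in> perfect_matchings G"
proof -
  have "card {d \<in> out_darts v. edge_of d \<in> matching_of I} = 1" if v: "v \<in> V" for v
  proof -
    define x where "x f = (of_bool (f \<in> I) :: int)" for f
    define y where "y f = (of_bool (f = outer) :: int)" for f
    have reindex: "(\<Sum>d \<in> out_darts v. g (L (rot d))) = (\<Sum>d \<in> out_darts v. g (L d))" for g :: "'a face \<Rightarrow> int"
      using bij_rot by (rule sum.reindex_bij_betw)
    have y: "(\<Sum>d \<in> out_darts v. y (L d)) = 1"
      using card_outer_corners[OF v] by (simp add: y_def Int_def)
    have "(\<Sum>d \<in> out_darts v. of_bool (edge_of d \<in> matching_of I)) = (1 :: int)"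
    proof (cases "c v = White")
      case True
      have "(\<Sum>d \<in> out_darts v. of_bool (edge_of d \<in> matching_of I)) =
        (\<Sum>d \<in> out_darts v. x (L (rot d)) - x (L d) + y (L (rot d)))"
        using True edge_of_in_matching_of_int[OF I]
        by (intro sum.cong) (simp_all add: out_darts_def x_def y_def)
      then show ?thesis
        by (simp add: sum.distrib sum_subtractf reindex y)
    next
      case False
      \<comment> \<open>At a black vertex the white dart of each edge is the reverse of
        \<open>d\<close>, so head and tail face of the dual arc exchange roles.\<close>
      have "(\<Sum>d \<in> out_darts v. of_bool (edge_of d \<in> matching_of I)) =
        (\<Sum>d \<in> out_darts v. x (L d) - x (L (rot d)) + y (L d))"
      proof (rule sum.cong)
        fix d assume "d \<in> out_darts v"
        with False have d: "d \<in> D" "white (prod.swap d)"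
          by (simp_all add: out_darts_def)
        then show "of_bool (edge_of d \<in> matching_of I) = x (L d) - x (L (rot d)) + y (L d)"
          using edge_of_in_matching_of_int[OF I, of "prod.swap d"] by (simp add: x_def y_def)
      qed simp
      then show ?thesis
        by (simp add: sum.distrib sum_subtractf reindex y)
    qed
    then show ?thesis by (simp add: Int_def)
  qed
  then show ?thesis
    by (simp add: perfect_matching_iff matching_of_subset)
qed

lemma white_dart_of_edge:
  assumes "e \<in> E"
  obtains d where "d \<in> D" "white d" "e = edge_of d"
proof -
  obtain d where d: "d \<in> D" "e = edge_of d"
    using assms by (auto simp: edges_def)
  show thesis
    using that[of d] that[of "prod.swap d"] d by (cases "white d") auto
qed

text \<open>In the parity formula the \<open>outer\<close> term is the same for both ideals and
  cancels.\<close>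

lemma sym_diff_matching_of:
  assumes "I \<in> ideals" "J \<in> ideals"
  shows "sym_diff (matching_of I) (matching_of J) = boundary (sym_diff I J)"
proof -
  have "e \<in> sym_diff (matching_of I) (matching_of J) \<longleftrightarrow> e \<in> boundary (sym_diff I J)" if "e \<in> E" for e
  proof -
    obtain d where d: "d \<in> D" "white d" "e = edge_of d"
      using white_dart_of_edge[OF \<open>e \<in> E\<close>] .
    show ?thesis
      unfolding d(3)
      using edge_of_in_matching_of_parity[OF assms(1) d(1,2)]
        edge_of_in_matching_of_parity[OF assms(2) d(1,2)] edge_of_in_boundary[OF d(1)]
      by auto
  qed
  moreover have "sym_diff (matching_of I) (matching_of J) \<subseteq> E"
    using matching_of_subset by blast
  ultimately show ?thesis
    using boundary_subset by blast
qed

lemma matching_of_inj: "inj_on matching_of ideals"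
proof (rule inj_onI)
  fix I J assume IJ: "I \<in> ideals" "J \<in> ideals" "matching_of I = matching_of J"
  then have "boundary (sym_diff I J) = {}"
    using sym_diff_matching_of[OF IJ(1,2)] by simp
  moreover have "boundary {} = {}"
    by (simp add: boundary_def)
  ultimately have "sym_diff I J = {}"
    using IJ(1,2) by (intro boundary_inj[of _ outer]) (auto simp: ideal_iff inner_faces_def)
  then show "I = J" by blast
qed

lemma empty_ideal: "{} \<in> ideals"
  by (simp add: ideal_iff)

lemma perfect_matching_is_matching_of:
  assumes M: "M \<in> perfect_matchings G"
  obtains I where "I \<in> ideals" "M = matching_of I"
proof -
  have ME: "M \<subseteq> E"
    using M by (simp add: perfect_matching_iff)
  let ?B = "matching_of {}"
  have odd: "odd_at N v" if "N \<in> perfect_matchings G" "v \<in> V" for N v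
    using that card_edges_at[of N v] by (simp add: perfect_matching_iff odd_at_def)
  have "\<not> odd_at (sym_diff M ?B) v" if "v \<in> V" for v
    using odd[OF M that] odd[OF matching_of_perfect[OF empty_ideal] that]
      finite_subset_E[OF ME] finite_subset_E[OF matching_of_subset]
    by (simp add: odd_at_sym_diff)
  moreover have "sym_diff M ?B \<subseteq> E"
    using ME matching_of_subset by blast
  ultimately have "sym_diff M ?B \<in> cycle_space"
    by (simp add: cycle_space_def)
  then obtain X where X: "X \<subseteq> F - {outer}" "sym_diff M ?B = boundary X"
    by (rule cycle_space_boundary)
  have outer: "outer \<notin> X"
    using X(1) by blast
  \<comment> \<open>The parity formula of \<open>matching_of X\<close>, obtained for
    \<open>M\<close> before \<open>X\<close> is known to be an ideal.\<close>
  have par: "edge_of d \<in> M \<longleftrightarrow> ((L (prod.swap d) \<in> X) \<noteq> (L d \<in> X)) \<noteq> (L (prod.swap d) = outer)"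
    if d: "d \<in> D" "white d" for d
  proof -
    have "edge_of d \<in> M \<longleftrightarrow> (edge_of d \<in> ?B) \<noteq> (edge_of d \<in> boundary X)"
      using X(2) by blast
    then show ?thesis
      using edge_of_in_matching_of_parity[OF empty_ideal d] edge_of_in_boundary[OF d(1)] by auto
  qed
  have "L (prod.swap d) \<in> X"
    if d: "d \<in> D" "white d" "L d \<in> X" "L (prod.swap d) \<noteq> outer" for d
  proof (rule ccontr)
    assume notin: "L (prod.swap d) \<notin> X"
    then have "edge_of d \<in> M"
      using par[OF d(1,2)] d by simp
    moreover have "card {e \<in> out_darts (fst d). edge_of e \<in> M} = 1"
      using M dart_verts(1)[OF d(1)] by (simp add: perfect_matching_iff)
    then obtain d' where d': "{e \<in> out_darts (fst d). edge_of e \<in> M} = {d'}"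
      by (rule card_1_singletonE)
    have "e = d'" if "e \<in> D" "fst e = fst d" "edge_of e \<in> M" for e
      using eqset_imp_iff[OF d', of e] that by (simp add: out_darts_def)
    ultimately have only: "e = d" if "e \<in> D" "fst e = fst d" "edge_of e \<in> M" for e
      using that d(1) by metis
    \<comment> \<open>Turning starts at \<open>rot d\<close>, whose face is outside
      \<open>X\<close>. At the white vertex \<open>fst d\<close>, entering \<open>X\<close> would
      cross an edge of \<open>M\<close> other than that of \<open>d\<close>, so the round arrives at
      \<open>d\<close> still outside \<open>X\<close>.\<close>
    have "L d \<notin> X"
    proof (rule closed_under_rot[of "rot d" d "\<lambda>e. L e \<notin> X"])
      fix e assume e: "e \<in> D" "fst e = fst (rot d)" "L e \<notin> X"
      show "L (rot e) \<notin> X"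
      proof (cases "e = d")
        case True
        with notin d(1) show ?thesis by simp
      next
        case False
        then have "edge_of e \<notin> M"
          using only[of e] e d(1) by auto
        with par[of e] e d(1,2) outer show ?thesis by auto
      qed
    qed (use d notin in auto)
    with d(3) show False by simp
  qed
  then have ideal: "X \<in> ideals"
    using X(1) by (auto simp: ideal_iff inner_faces_def simp del: split_paired_All)
  have "e \<in> M \<longleftrightarrow> e \<in> matching_of X" if "e \<in> E" for e
  proof -
    obtain d where d: "d \<in> D" "white d" "e = edge_of d"
      using white_dart_of_edge[OF \<open>e \<in> E\<close>] .
    with par[of d] edge_of_in_matching_of_parity[OF ideal, of d] show ?thesis by simp
  qed
  then have "M = matching_of X"
    using ME matching_of_subset by blast
  with ideal that show thesis by blast
qed

subsection \<open>Rotating a face\<close>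

lemma boundary_singleton:
  assumes "f \<in> F"
  shows "boundary {f} = edge_of ` f"
proof -
  have "e \<in> boundary {f} \<longleftrightarrow> e \<in> edge_of ` f" if "e \<in> E" for e
  proof -
    obtain d where d: "d \<in> D" "e = edge_of d"
      using \<open>e \<in> E\<close> by (auto simp: edges_def)
    have "e \<in> edge_of ` f \<longleftrightarrow> d \<in> f \<or> prod.swap d \<in> f"
      unfolding d(2) image_iff edge_of_eq_iff by (metis swap_swap)
    also have "\<dots> \<longleftrightarrow> L d = f \<or> L (prod.swap d) = f"
      using d(1) by (simp add: in_face_iff[OF assms])
    finally show ?thesis
      unfolding d(2) using edge_of_in_boundary[OF d(1), of "{f}"] left_face_neq_swap[OF d(1)] by auto
  qed
  moreover have "edge_of ` f \<subseteq> E"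
    using in_face_iff[OF assms] by auto
  ultimately show ?thesis
    using boundary_subset by blast
qed

text \<open>Arcs leaving \<open>f\<close> end in \<open>I\<close> or at \<open>outer\<close>, as
  \<open>insert f I\<close> is an ideal; arcs entering \<open>f\<close> do not start in
  \<open>I\<close>, as \<open>I\<close> is an ideal without \<open>f\<close>.\<close>

lemma face_edges_in_matching_of:
  assumes "I \<in> ideals" "insert f I \<in> ideals" "f \<notin> I" "d \<in> D" "L d = f"
  shows "edge_of d \<in> matching_of I \<longleftrightarrow> white d"
    and "edge_of d \<in> matching_of (insert f I) \<longleftrightarrow> \<not> white d"
proof -
  have f: "f \<noteq> outer"
    using assms(2) outer_notin_ideal by blast
  have neq: "L (prod.swap d) \<noteq> f"
    using left_face_neq_swap[OF assms(4)] assms(5) by simp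
  have *: "(edge_of d \<in> matching_of I \<longleftrightarrow> white d) \<and>
    (edge_of d \<in> matching_of (insert f I) \<longleftrightarrow> \<not> white d)"
  proof (cases "white d")
    case True
    then have "L (prod.swap d) \<in> insert outer I"
      using assms(2)[unfolded ideal_iff] assms(4,5) neq by auto
    with True assms neq show ?thesis
      by (simp add: edge_of_in_matching_of)
  next
    case False
    then have w: "prod.swap d \<in> D" "white (prod.swap d)"
      using assms(4) by auto
    have "L (prod.swap d) \<notin> I"
      using bspec[OF conjunct2[OF assms(1)[unfolded ideal_iff]] w(1)] w(2) assms(3,5) f by auto
    with False w assms(3,5) neq f show ?thesis
      using edge_of_in_matching_of[OF w, of I] edge_of_in_matching_of[OF w, of "insert f I"] by simp
  qed
  from * show "edge_of d \<in> matching_of I \<longleftrightarrow> white d" ..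
  from * show "edge_of d \<in> matching_of (insert f I) \<longleftrightarrow> \<not> white d" ..
qed

abbreviation "rotations \<equiv> parcs (matching_digraph G rot outer c)"

text \<open>Colours alternate along \<open>f\<close>, and once \<open>f\<close> is added its matched
  darts are those with black tail. They run counterclockwise, so clockwise the matched edges go from
  white to black.\<close>

lemma rotation_add_face:
  assumes "I \<in> ideals" "insert f I \<in> ideals" "f \<notin> I"
  shows "(matching_of (insert f I), matching_of I) \<in> rotations"
proof -
  let ?M = "matching_of (insert f I)"
  have f: "f \<in> inner"
    using assms(2) by (simp add: ideal_iff)
  then have fF: "f \<in> F"
    by (simp add: inner_iff)
  note edge = face_edges_in_matching_of(2)[OF assms]
  have "sym_diff (insert f I) I = {f}"
    using assms(3) by blast
  then have "sym_diff ?M (matching_of I) = edge_of ` f"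
    using sym_diff_matching_of[OF assms(2,1)] boundary_singleton[OF fF] by simp
  moreover have "alternating rot ?M f"
    unfolding alternating_def
  proof
    fix d assume "d \<in> f"
    then have d: "d \<in> D" "L d = f"
      by (simp_all add: in_face_iff[OF fF])
    then have "edge_of (face_succ rot d) \<in> ?M \<longleftrightarrow> white d"
      using edge[of "face_succ rot d"] white_swap[of d] by (simp add: face_succ_def)
    with edge[OF d] show "edge_of d \<in> ?M \<longleftrightarrow> edge_of (face_succ rot d) \<notin> ?M" by simp
  qed
  moreover have "proper c ?M f"
    unfolding proper_def
  proof clarsimp
    fix v u assume "(v, u) \<in> f" "{u, v} \<in> ?M"
    then have d: "(v, u) \<in> D" "L (v, u) = f" "edge_of (v, u) \<in> ?M"
      by (simp_all add: in_face_iff[OF fF] edge_of_def insert_commute)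
    then have "c v \<noteq> White"
      using edge[OF d(1,2)] by simp
    then show "c u = White \<and> c v = Black"
      using white_swap[OF d(1)] by (cases "c v") simp_all
  qed
  ultimately show ?thesis
    using f facial_cycle[OF fF] matching_of_perfect assms(1,2)
    by (auto simp: matching_digraph_def)
qed

text \<open>By injectivity of \<open>boundary\<close> the ideals differ only in the rotated face. If
  that face were added, its matched darts before the rotation would have white tails, against
  properness.\<close>

lemma rotation_decreases:
  assumes I: "I \<in> ideals" and J: "J \<in> ideals" and rot: "(matching_of I, matching_of J) \<in> rotations"
  shows "J \<subseteq> I"
proof -
  obtain f where f: "f \<in> inner" "sym_diff (matching_of I) (matching_of J) = edge_of ` f"
    "proper c (matching_of I) f"
    using rot by (auto simp: matching_digraph_def)
  then have fF: "f \<in> F"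
    by (simp add: inner_iff)
  have "boundary (sym_diff I J) = boundary {f}"
    using f(2) sym_diff_matching_of[OF I J] boundary_singleton[OF fF] by simp
  then have diff: "sym_diff I J = {f}"
    using I J f(1) by (intro boundary_inj[of _ outer]) (auto simp: ideal_iff inner_faces_def)
  show ?thesis
  proof (rule ccontr)
    assume "\<not> J \<subseteq> I"
    then obtain g where g: "g \<in> J" "g \<notin> I" by blast
    have x: "x \<in> I \<and> x \<notin> J \<or> x \<in> J \<and> x \<notin> I \<longleftrightarrow> x = f" for x
      using eqset_imp_iff[OF diff, of x] by simp
    have fJ: "f \<in> J" and fI: "f \<notin> I"
      using x[of g] g by simp_all
    have J_eq: "J = insert f I"
    proof (rule set_eqI)
      show "y \<in> J \<longleftrightarrow> y \<in> insert f I" for y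
        using x[of y] fJ fI by (cases "y = f") auto
    qed
    obtain d where d: "d \<in> D" "L d = f"
      using face_nonempty[OF fF] .
    obtain e where e: "e \<in> D" "L e = f" "white e"
    proof (cases "white d")
      case False
      then show thesis
        using that[of "face_succ rot d"] d white_swap[of d] by (simp add: face_succ_def)
    qed (use d that in blast)
    have "edge_of e \<in> matching_of I"
      using face_edges_in_matching_of(1)[OF I J[unfolded J_eq] fI e(1,2)] e(3) by simp
    moreover have "prod.swap e \<in> prod.swap ` f"
      using e by (simp add: in_face_iff[OF fF])
    ultimately have "c (snd e) = White"
      using f(3) unfolding proper_def by (cases e) (auto simp: edge_of_def insert_commute)
    with white_swap[OF e(1)] e(3) show False by simp
  qed
qed

lemma rotations_of_subset:
  assumes "I \<in> ideals" "J \<in> ideals" "I \<subseteq> J"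
  shows "(matching_of J, matching_of I) \<in> rtrancl_on (perfect_matchings G) rotations"
  using assms
proof (induction "card (J - I)" arbitrary: I rule: less_induct)
  case less
  show ?case
  proof (cases "I = J")
    case True
    then show ?thesis
      using matching_of_perfect[OF less.prems(1)] by simp
  next
    case False
    have K: "J - I \<subseteq> inner"
      using less.prems(2) by (auto simp: ideal_iff)
    \<comment> \<open>Every arc from a sink of \<open>J - I\<close> ends in \<open>I\<close> or at
      \<open>outer\<close>, because \<open>J\<close> is an ideal; hence \<open>insert f I\<close> is
      again an ideal.\<close>
    obtain f where f: "f \<in> J - I"
      "\<And>d. d \<in> D \<Longrightarrow> white d \<Longrightarrow> L d = f \<Longrightarrow> L (prod.swap d) \<notin> J - I"
      using sink_face[OF K] False less.prems(3) by blast
    have ideal: "insert f I \<in> ideals"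
      unfolding ideal_iff
    proof (intro conjI ballI impI)
      show "insert f I \<subseteq> inner"
        using K f(1) less.prems(1) by (auto simp: ideal_iff)
      fix d assume d: "d \<in> D" "white d" "L d \<in> insert f I" "L (prod.swap d) \<noteq> outer"
      have "L d \<in> J"
        using d(3) f(1) less.prems(3) by blast
      then have "L (prod.swap d) \<in> J"
        using less.prems(2)[unfolded ideal_iff] d by blast
      then show "L (prod.swap d) \<in> insert f I"
        using d f(2)[OF d(1,2)] less.prems(1)[unfolded ideal_iff] by blast
    qed
    have "finite (J - I)"
      using K by (rule finite_subset) (simp add: inner_faces_def)
    then have "(matching_of J, matching_of (insert f I)) \<in> rtrancl_on (perfect_matchings G) rotations"
      using f(1) less.prems ideal by (intro less.hyps psubset_card_mono) auto
    moreover have "(matching_of (insert f I), matching_of I) \<in> rotations"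
      using f(1) less.prems(1) ideal by (intro rotation_add_face) auto
    ultimately show ?thesis
      using matching_of_perfect[OF less.prems(1)] by (rule rtrancl_on_into_rtrancl_on)
  qed
qed

text \<open>Every intermediate matching comes from an ideal, so \<open>rotation_decreases\<close>
  applies to each arc of the path.\<close>

lemma subset_of_rotations:
  assumes "(M, N) \<in> rtrancl_on (perfect_matchings G) rotations"
    and "M = matching_of J" "N = matching_of I" "I \<in> ideals" "J \<in> ideals"
  shows "I \<subseteq> J"
  using assms
proof (induction arbitrary: I rule: rtrancl_on_induct)
  case base
  then show ?case
    using inj_onD[OF matching_of_inj, of I J] by simp
next
  case (step y z)
  obtain K where K: "K \<in> ideals" "y = matching_of K"
    using perfect_matching_is_matching_of[OF step.hyps(3)] .
  with step have "K \<subseteq> J" by blast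
  moreover have "I \<subseteq> K"
    using rotation_decreases[OF K(1) step.prems(3)] step.hyps(2) step.prems(2) K(2) by simp
  ultimately show ?case by blast
qed

section \<open>The order isomorphism\<close>

lemma matching_poset_iff:
  assumes "I \<in> ideals" "J \<in> ideals"
  shows "(matching_of I, matching_of J) \<in> matching_poset G rot outer c \<longleftrightarrow> I \<subseteq> J"
proof -
  have "verts (with_proj (matching_digraph G rot outer c)) = perfect_matchings G"
    by (simp add: matching_digraph_def)
  then show ?thesis
    using rotations_of_subset[OF assms] subset_of_rotations[OF _ refl refl assms]
      matching_of_perfect assms
    by (auto simp: matching_poset_def reachable_def)
qed

lemma matching_of_bij: "bij_betw matching_of ideals (perfect_matchings G)"
  unfolding bij_betw_def
  using matching_of_inj matching_of_perfect perfect_matching_is_matching_of by blast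

theorem matching_poset_isomorphic:
  "poset_isomorphic (matching_poset G rot outer c) (ideal_lattice (face_poset G rot outer c))"
proof -
  let ?h = "inv_into ideals matching_of"
  have Field_M: "Field (matching_poset G rot outer c) = perfect_matchings G"
  proof (intro equalityI subsetI)
    fix M assume "M \<in> perfect_matchings G"
    then have "(M, M) \<in> matching_poset G rot outer c"
      by (simp add: matching_poset_def reachable_def) (simp add: matching_digraph_def)
    then show "M \<in> Field (matching_poset G rot outer c)"
      by (auto simp: Field_def)
  qed (auto simp: Field_def matching_poset_def)
  have Field_I: "Field (ideal_lattice (face_poset G rot outer c)) = ideals"
    by (auto simp: Field_def ideal_lattice_def)
  have "(M, N) \<in> matching_poset G rot outer c \<longleftrightarrow>
      (?h M, ?h N) \<in> ideal_lattice (face_poset G rot outer c)"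
    if MN: "M \<in> perfect_matchings G" "N \<in> perfect_matchings G" for M N
  proof -
    have "?h M \<in> ideals" "?h N \<in> ideals"
      using MN bij_betwE[OF bij_betw_inv_into[OF matching_of_bij]] by blast+
    moreover have "matching_of (?h M) = M" "matching_of (?h N) = N"
      using MN bij_betw_inv_into_right[OF matching_of_bij] by blast+
    ultimately show ?thesis
      using matching_poset_iff[of "?h M" "?h N"] by (simp add: ideal_lattice_def)
  qed
  then show ?thesis
    unfolding poset_isomorphic_def Field_M Field_I
    using bij_betw_inv_into[OF matching_of_bij] by blast
qed

end

theorem theorem5p4:
  fixes G :: "'a pair_pre_digraph"
    and rot :: "'a dart \<Rightarrow> 'a dart"
    and outer :: "'a face"
    and c :: "'a \<Rightarrow> color"
  assumes "outerplane_graph G rot outer"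
    and "two_connected G"
    and "proper_coloring G c"
  shows "poset_isomorphic (matching_poset G rot outer c)
           (ideal_lattice (face_poset G rot outer c))"
proof -
  interpret outerplane_bipartite G rot outer c
    by unfold_locales (use assms in \<open>simp_all add: outerplane_graph_def\<close>)
  show ?thesis by (rule matching_poset_isomorphic)
qed

end
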